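(* Let $n\in\mathbb{N}$ and $K\subseteq[2,n+1]$. For every set $W\subseteq[2,n+1]$ denote $W^{\max}=W\cup\{n+2\}$ and $W^{\min}=W\cup\{1\}$, and for $s\in\mathbb{N}$ put $\tau_s(i):=s+3-i$. Then $$|R([2,n+2]\smallsetminus K^{\max})|=|R([2,n+1]\smallsetminus K)|$$ and \begin{align*} |R([2,n+2]\smallsetminus K)|&=\sum_{J\subseteq[2,n+1]\smallsetminus K}(-1)^{n-|K|-|J|}\bigl(\alpha(J^{\max})\hat{!}-\alpha(J)\hat{!}\bigr)\\ &=\sum_{J\subseteq[2,n+1]\smallsetminus \tau_{n}(K)}(-1)^{n-|K|-|J|}\bigl(\alpha(\tau_{n}(J^{\min}))\hat{!}-\alpha(\tau_{n}(J))\hat{!}\bigr)\\ &=\sum_{J\subseteq K}(-1)^{|K|-|J|}\alpha(\tau_{n+1}(J))\hat{!}\\ &=\sum_{J\subseteq K}(-1)^{|K|-|J|}(|J|+1)\,\alpha(\tau_{n}(J))\hat{!}\\ &=|R(\tau_{n+1}(K))|. \end{align*}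
   Context: Notation: $[m]=\{1,\dots,m\}$ and $[a,b]=\{a,a+1,\dots,b\}$ (empty if $a>b$). $\mathfrak{S}_{m+1}$ is the symmetric group on $[m+1]$, with permutations written in one-line notation $\sigma=(\sigma_1\cdots\sigma_{m+1})$. The descent top set of $\sigma\in\mathfrak{S}_{m+1}$ is $\mathcal{DT}(\sigma)=\{\sigma_i \mid i\in[m],\ \sigma_i>\sigma_{i+1}\}\subseteq[2,m+1]$. For $S\subseteq[m+1]$, $R(m,S):=\{\sigma\in\mathfrak{S}_{m+1}\mid \mathcal{DT}(\sigma)=S\}$. The cardinality $|R(m,S)|$ does not depend on $m$ as long as $S\subseteq[m+1]$, and $|R(S)|$ denotes this common value (for the sets in the claim one may take $m=n+1$, i.e. permutations in $\mathfrak{S}_{n+2}$). For a finite set of positive integers $X=\{x_1<\dots<x_k\}$, $\alpha(X):=(x_1-1,\,x_2-x_1,\,x_3-x_2,\dots,x_k-x_{k-1})$. For a tuple $\beta=(\beta_1,\dots,\beta_k)$ of nonnegative integers, $\beta\hat{!}:=(k+1)^{\beta_1}k^{\beta_2}\cdots 3^{\beta_{k-1}}2^{\beta_k}$. By convention $\alpha(\emptyset)=()$ and $()\hat{!}=1$. For a set $W$, $\tau_s(W)=\{\tau_s(w)\mid w\in W\}$. *)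

theory Defs
  imports "HOL-Combinatorics.Permutations"
begin

text \<open>
  A permutation \<open>\<sigma>\<close> of \<open>[m+1]\<close> is a function with \<open>\<sigma> permutes {1..m+1}\<close>; its one-line
  notation is \<open>\<sigma> 1, \<dots>, \<sigma> (m+1)\<close>.
\<close>

definition descent_tops :: "nat \<Rightarrow> (nat \<Rightarrow> nat) \<Rightarrow> nat set" where
  "descent_tops m \<sigma> = {\<sigma> i | i. i \<in> {1..m} \<and> \<sigma> i > \<sigma> (i + 1)}"

definition R :: "nat \<Rightarrow> nat set \<Rightarrow> (nat \<Rightarrow> nat) set" where
  "R m S = {\<sigma>. \<sigma> permutes {1..m + 1} \<and> descent_tops m \<sigma> = S}"

text \<open>
  The value \<open>|R(S)|\<close> shared by all \<open>card (R m S)\<close> with \<open>S \<subseteq> [m+1]\<close>. It exists for every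
  finite \<open>S\<close> of positive integers: see \<open>card_R_eq_R_count\<close> below.
\<close>
definition R_count :: "nat set \<Rightarrow> nat" where
  "R_count S = (THE c. \<forall>m. S \<subseteq> {1..m + 1} \<longrightarrow> card (R m S) = c)"

lemma R_Suc:
  assumes S: "S \<subseteq> {1..m + 1}"
  shows "R (Suc m) S = R m S"
proof -
  have tops_eq: "descent_tops (Suc m) \<sigma> = descent_tops m \<sigma>"
    if "\<sigma> permutes {1..m + 1}" for \<sigma>
  proof -
    have "\<sigma> (m + 2) = m + 2"
      using permutes_not_in[OF that, of "m + 2"] by simp
    moreover have "\<sigma> (m + 1) \<le> m + 1"
      using permutes_in_image[OF that, of "m + 1"] by simp
    ultimately have "i \<in> {1..Suc m} \<and> \<sigma> i > \<sigma> (i + 1) \<longleftrightarrow> i \<in> {1..m} \<and> \<sigma> i > \<sigma> (i + 1)" for i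
      by (cases "i = m + 1") auto
    then show ?thesis
      unfolding descent_tops_def by presburger
  qed
  have fixed: "\<sigma> permutes {1..m + 1}"
    if p: "\<sigma> permutes {1..Suc m + 1}" and d: "descent_tops (Suc m) \<sigma> = S" for \<sigma>
  proof -
    have "m + 2 \<in> \<sigma> ` {1..Suc m + 1}"
      unfolding permutes_image[OF p] by simp
    then obtain i where i: "i \<in> {1..Suc m + 1}" "\<sigma> i = m + 2"
      by (metis imageE)
    have "i = m + 2"
    proof (rule ccontr)
      assume ne: "i \<noteq> m + 2"
      have "i + 1 \<in> {1..Suc m + 1}"
        using i(1) ne by auto
      then have "\<sigma> (i + 1) \<in> {1..Suc m + 1}"
        using permutes_in_image[OF p] by blast
      moreover have "\<sigma> (i + 1) \<noteq> \<sigma> i"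
        using permutes_inj[OF p] by (metis Suc_eq_plus1 injD n_not_Suc_n)
      ultimately have "\<sigma> i > \<sigma> (i + 1)"
        using i(2) by auto
      then have "m + 2 \<in> descent_tops (Suc m) \<sigma>"
        unfolding descent_tops_def using i ne by (intro CollectI exI[of _ i]) auto
      then show False
        using d S by auto
    qed
    then have "\<sigma> (m + 2) = m + 2"
      using i(2) by simp
    moreover have "x = m + 2" if "x \<in> {1..Suc m + 1} - {1..m + 1}" for x
      using that by auto
    ultimately show ?thesis
      using permutes_superset[OF p] by metis
  qed
  have extended: "\<sigma> permutes {1..Suc m + 1}" if "\<sigma> permutes {1..m + 1}" for \<sigma>
    by (rule permutes_subset[OF that]) auto
  have "\<sigma> \<in> R (Suc m) S \<longleftrightarrow> \<sigma> \<in> R m S" for \<sigma>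
    unfolding R_def mem_Collect_eq using tops_eq fixed extended by metis
  then show ?thesis
    by (rule set_eqI)
qed

lemma R_mono:
  assumes "S \<subseteq> {1..m + 1}" "m \<le> m'"
  shows "R m' S = R m S"
  using assms(2)
proof (induction m' rule: dec_induct)
  case (step k)
  then have "S \<subseteq> {1..k + 1}"
    using assms(1) by fastforce
  then show ?case
    using R_Suc[of S k] step.IH by simp
qed simp

lemma card_R_eq_R_count:
  assumes "S \<subseteq> {1..m + 1}"
  shows "card (R m S) = R_count S"
proof -
  have "\<forall>m'. S \<subseteq> {1..m' + 1} \<longrightarrow> card (R m' S) = card (R m S)"
  proof (intro allI impI)
    fix m' assume S': "S \<subseteq> {1..m' + 1}"
    show "card (R m' S) = card (R m S)"
      using R_mono[OF assms, of m'] R_mono[OF S', of m] by (cases "m \<le> m'") simp_all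
  qed
  then have "R_count S = card (R m S)"
    unfolding R_count_def using assms by (blast intro!: the_equality)
  then show ?thesis
    by simp
qed

text \<open>
  For \<open>X = {x\<^sub>1 < \<dots> < x\<^sub>k}\<close> this is \<open>(x\<^sub>1 - 1, x\<^sub>2 - x\<^sub>1, \<dots>, x\<^sub>k - x\<^sub>k\<^sub>-\<^sub>1)\<close>. The subtraction on
  \<open>nat\<close> never truncates when \<open>X\<close> consists of positive integers.
\<close>
definition alpha :: "nat set \<Rightarrow> nat list" where
  "alpha X = (let xs = sorted_list_of_set X in
     map (\<lambda>i. xs ! i - (if i = 0 then 1 else xs ! (i - 1))) [0..<length xs])"

text \<open>
  With list positions counted from \<open>0\<close>, the entry at position \<open>i\<close> of a tuple of length \<open>k\<close> is the
  exponent of \<open>k + 1 - i\<close>.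
\<close>
definition hat_fact :: "nat list \<Rightarrow> nat" where
  "hat_fact \<beta> = (\<Prod>i<length \<beta>. (length \<beta> + 1 - i) ^ (\<beta> ! i))"

text \<open>Subtraction on \<open>nat\<close>; this is the integer \<open>s + 3 - i\<close> as long as \<open>i \<le> s + 3\<close>.\<close>
definition tau :: "nat \<Rightarrow> nat \<Rightarrow> nat" where
  "tau s i = s + 3 - i"

definition set_max :: "nat \<Rightarrow> nat set \<Rightarrow> nat set" where
  "set_max n W = W \<union> {n + 2}"

definition set_min :: "nat set \<Rightarrow> nat set" where
  "set_min W = W \<union> {1}"

end

theory Submission
  imports Defs "HOL-Combinatorics.Multiset_Permutations"
begin

text \<open>
  Write a permutation as a word. Build a word by inserting its letters in decreasing order. A new
  smallest letter \<open>x\<close> is never a descent top, it turns the letter before it into one, and it changes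
  no other letter. Hence all descent tops stay in \<open>S\<close> exactly if \<open>x\<close> is put at the front or right
  after a letter of \<open>S\<close>, which leaves \<open>1 + |{s \<in> S. x < s}|\<close> places. So the permutations whose
  descent tops lie in \<open>S\<close> are counted by the product of these numbers (\<open>card_tops_subset\<close>), and this
  product is the hat factorial of \<open>\<alpha>(S)\<close> (\<open>hat_fact_alpha\<close>). Moebius inversion over the subsets of
  \<open>S\<close> then gives \<open>|R(S)|\<close> as an alternating sum of hat factorials
  (\<open>R_count_inclusion_exclusion\<close>).

  The first sum of the theorem is this formula for \<open>S = ([2,n+1] - K) \<union> {n+2}\<close>, where the term
  of \<open>J\<close> is paired with that of \<open>J \<union> {n+2}\<close>. The second sum is the first one, reindexed by the
  involution \<open>\<tau>\<^sub>n\<close> of \<open>[2,n+1]\<close>.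

  The remaining formulas rest on the equality of \<open>|R([2,n+2] - K)|\<close> and \<open>|R(\<tau>\<^sub>n\<^sub>+\<^sub>1(K))|\<close>, which is
  bijective (\<open>card_tops_complement\<close>). Let \<open>c = \<tau>\<^sub>n\<^sub>+\<^sub>1\<close>, the order-reversing involution of
  \<open>[2,n+2]\<close>, and send the word \<open>u 1 v\<close> to \<open>c(v) 1 c(u)\<close>. Inside \<open>u\<close> and inside \<open>v\<close> this turns
  descents into ascents and conversely. The last letter of \<open>u\<close> was followed by \<open>1\<close> and becomes the
  last letter of the whole word, so it stops being a descent top; for the last letter of \<open>v\<close> it is
  the other way round. Therefore \<open>c(a)\<close> is a descent top of the new word if and only if
  \<open>a \<ge> 2\<close> is not one of the old word: the descent top set \<open>D\<close> becomes \<open>c([2,n+2] - D)\<close>.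
  Inclusion-exclusion for \<open>\<tau>\<^sub>n\<^sub>+\<^sub>1(K)\<close> is the third sum. The fourth follows from
  \<open>\<tau>\<^sub>n\<^sub>+\<^sub>1(J) = \<tau>\<^sub>n(J) + 1\<close>, because a shift by one only adds the factor of the ground element \<open>1\<close>
  to the product, and this factor is \<open>|J| + 1\<close> (\<open>hat_fact_alpha_Suc\<close>).
\<close>

section \<open>Descent tops of words\<close>

fun tops :: "nat list \<Rightarrow> nat set" where
  "tops (x # y # zs) = (if y < x then insert x (tops (y # zs)) else tops (y # zs))"
| "tops _ = {}"

lemma tops_subset_set: "tops xs \<subseteq> set xs"
  by (induction xs rule: tops.induct) auto

lemma tops_append:
  "tops (xs @ ys) = tops xs \<union> tops ys
    \<union> (if xs \<noteq> [] \<and> ys \<noteq> [] \<and> hd ys < last xs then {last xs} else {})"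
proof (induction xs rule: tops.induct)
  case ("2_2" v)
  then show ?case
    by (cases ys) auto
qed auto

text \<open>The common letter \<open>y\<close> is kept in both parts, so that no adjacent pair is lost.\<close>
lemma tops_append_Cons: "tops (xs @ y # ys) = tops (xs @ [y]) \<union> tops (y # ys)"
  by (auto simp: tops_append)

lemma tops_Cons_min: "\<forall>y\<in>set ys. z < y \<Longrightarrow> tops (z # ys) = tops ys"
  by (cases ys) auto

lemma descent_tops_eq_tops: "descent_tops m \<sigma> = tops (map \<sigma> [1..<m + 2])"
proof (induction m)
  case 0
  then show ?case
    by (simp add: descent_tops_def)
next
  case (Suc m)
  have "descent_tops (Suc m) \<sigma>
      = descent_tops m \<sigma> \<union> (if \<sigma> (m + 2) < \<sigma> (m + 1) then {\<sigma> (m + 1)} else {})"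
    unfolding descent_tops_def by (auto simp: le_Suc_eq)
  also have "\<dots> = tops (map \<sigma> [1..<m + 1] @ [\<sigma> (m + 1), \<sigma> (m + 2)])"
    unfolding Suc.IH by (auto simp: tops_append)
  also have "map \<sigma> [1..<m + 1] @ [\<sigma> (m + 1), \<sigma> (m + 2)] = map \<sigma> [1..<Suc m + 2]"
    by simp
  finally show ?case .
qed

lemma one_line_bij:
  "bij_betw (\<lambda>\<sigma>. map \<sigma> [1..<M + 1]) {\<sigma>. \<sigma> permutes {1..M}} (permutations_of_set {1..M})"
proof -
  let ?L = "\<lambda>\<sigma>::nat \<Rightarrow> nat. map \<sigma> [1..<M + 1]"
  let ?P = "{\<sigma>::nat \<Rightarrow> nat. \<sigma> permutes {1..M}}"
  have inj: "inj_on ?L ?P"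
  proof (rule inj_onI)
    fix \<sigma> \<rho> :: "nat \<Rightarrow> nat"
    assume p: "\<sigma> \<in> ?P" "\<rho> \<in> ?P" and eq: "?L \<sigma> = ?L \<rho>"
    show "\<sigma> = \<rho>"
    proof
      fix i
      show "\<sigma> i = \<rho> i"
      proof (cases "i \<in> {1..M}")
        case True
        then have "i \<in> set [1..<M + 1]"
          by auto
        then show ?thesis
          using eq unfolding map_eq_conv by blast
      next
        case False
        then show ?thesis
          using p permutes_not_in by (metis mem_Collect_eq)
      qed
    qed
  qed
  have "?L \<sigma> \<in> permutations_of_set {1..M}" if p: "\<sigma> permutes {1..M}" for \<sigma>
  proof (rule permutations_of_setI)
    have "set [1..<M + 1] = {1..M}"
      by auto
    then show "set (?L \<sigma>) = {1..M}"
      unfolding set_map using permutes_image[OF p] by simp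
    show "distinct (?L \<sigma>)"
      using permutes_inj_on[OF p] by (simp add: distinct_map)
  qed
  then have sub: "?L ` ?P \<subseteq> permutations_of_set {1..M}"
    by auto
  have "card (?L ` ?P) = card (permutations_of_set {1..M})"
    unfolding card_image[OF inj] using card_permutations[of "{1..M}" M] by simp
  then show ?thesis
    unfolding bij_betw_def using inj card_subset_eq[OF _ sub] by simp
qed

lemma R_count_eq_card_words:
  assumes "S \<subseteq> {1..M}" "0 < M"
  shows "R_count S = card {xs \<in> permutations_of_set {1..M}. tops xs = S}"
proof -
  obtain m where M: "M = m + 1"
    using assms(2) by (metis Suc_eq_plus1 gr0_implies_Suc)
  let ?L = "\<lambda>\<sigma>::nat \<Rightarrow> nat. map \<sigma> [1..<M + 1]"
  have tops: "descent_tops m \<sigma> = tops (?L \<sigma>)" for \<sigma>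
    unfolding descent_tops_eq_tops M by (simp add: numeral_2_eq_2)
  have b: "bij_betw ?L {\<sigma>. \<sigma> permutes {1..M}} (permutations_of_set {1..M})"
    by (rule one_line_bij)
  have "bij_betw ?L {\<sigma>. \<sigma> permutes {1..M} \<and> tops (?L \<sigma>) = S}
      {xs \<in> permutations_of_set {1..M}. tops xs = S}"
  proof (rule bij_betw_subset[OF b])
    show "?L ` {\<sigma>. \<sigma> permutes {1..M} \<and> tops (?L \<sigma>) = S} = {xs \<in> permutations_of_set {1..M}. tops xs = S}"
      unfolding bij_betw_imp_surj_on[OF b, symmetric] by blast
  qed blast
  then have "card (R m S) = card {xs \<in> permutations_of_set {1..M}. tops xs = S}"
    unfolding R_def tops by (simp add: M bij_betw_same_card)
  then show ?thesis
    using card_R_eq_R_count[of S m] assms(1) M by simp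
qed

section \<open>Counting words whose descent tops lie in a given set\<close>

text \<open>
  Counts the admissible places for a new smallest letter. Inserting at \<open>i = 0\<close> means at the front,
  which is harmless; inserting at \<open>i > 0\<close> makes \<open>ys ! (i - 1)\<close> a descent top.
\<close>
lemma card_insert_positions:
  assumes "distinct ys"
  shows "card {i. i \<le> length ys \<and> (i = 0 \<or> ys ! (i - 1) \<in> S)} = 1 + card (set ys \<inter> S)"
proof -
  let ?I = "{i. i < length ys \<and> ys ! i \<in> S}"
  have split: "{i. i \<le> length ys \<and> (i = 0 \<or> ys ! (i - 1) \<in> S)} = insert 0 (Suc ` ?I)"
    by (auto simp: image_iff gr0_conv_Suc) (metis Suc_pred gr0I Suc_le_eq)
  have "inj_on ((!) ys) ?I"
    using assms by (auto intro!: inj_onI simp: nth_eq_iff_index_eq)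
  moreover have "(!) ys ` ?I = set ys \<inter> S"
    by (auto simp: in_set_conv_nth)
  ultimately have "card ?I = card (set ys \<inter> S)"
    by (metis card_image)
  moreover have "card (Suc ` ?I) = card ?I"
    by (rule card_image) simp
  ultimately show ?thesis
    unfolding split by simp
qed

text \<open>
  If \<open>us\<close> is nonempty, its last letter is always a descent top of \<open>us @ x # vs\<close>, whether or not it
  is one of \<open>us @ vs\<close>; the two words have the same descent tops otherwise.
\<close>
lemma tops_insert_min:
  assumes "\<forall>y\<in>set us \<union> set vs. x < y"
  shows "tops (us @ x # vs) \<subseteq> S \<longleftrightarrow> tops (us @ vs) \<subseteq> S \<and> (us = [] \<or> last us \<in> S)"
proof -
  have "tops (us @ x # vs) = tops us \<union> tops vs \<union> (if us = [] then {} else {last us})"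
    using assms by (simp add: tops_append tops_Cons_min)
  then show ?thesis
    by (auto simp: tops_append)
qed

text \<open>
  A word on \<open>insert x A\<close> is the same as a word \<open>ys\<close> on \<open>A\<close> together with the position of \<open>x\<close>. The
  number of admissible positions is the same for all admissible \<open>ys\<close>, which is why the count
  factors.
\<close>
lemma card_tops_subset_insert_min:
  assumes fin: "finite A" and min: "\<forall>a\<in>A. x < a"
  shows "card {xs \<in> permutations_of_set (insert x A). tops xs \<subseteq> S}
    = card {ys \<in> permutations_of_set A. tops ys \<subseteq> S} * (1 + card (A \<inter> S))"
proof -
  let ?G = "\<lambda>A. {xs \<in> permutations_of_set A. tops xs \<subseteq> S}"
  let ?I = "\<lambda>ys. {i. i \<le> length ys \<and> (i = 0 \<or> ys ! (i - 1) \<in> S)}"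
  let ?ins = "\<lambda>(ys, i). take i ys @ x # drop i ys"
  let ?del = "\<lambda>xs. (remove1 x xs, length (takeWhile (\<lambda>y. y \<noteq> x) xs))"
  have nx: "x \<notin> A"
    using min by auto
  have good: "tops (take i ys @ x # drop i ys) \<subseteq> S \<longleftrightarrow> tops ys \<subseteq> S \<and> i \<in> ?I ys"
    if "set ys = A" "i \<le> length ys" for ys i
  proof -
    have "\<forall>y\<in>set (take i ys) \<union> set (drop i ys). x < y"
      using that(1) min by (auto dest: in_set_takeD in_set_dropD)
    then have "tops (take i ys @ x # drop i ys) \<subseteq> S \<longleftrightarrow> tops ys \<subseteq> S \<and> (take i ys = [] \<or> last (take i ys) \<in> S)"
      by (subst tops_insert_min) simp_all
    moreover have "take i ys = [] \<or> last (take i ys) \<in> S \<longleftrightarrow> i = 0 \<or> ys ! (i - 1) \<in> S"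
      using that(2) by (cases i) (auto simp: take_Suc_conv_app_nth)
    ultimately show ?thesis
      using that(2) by simp
  qed
  have "bij_betw ?ins (SIGMA ys:?G A. ?I ys) (?G (insert x A))"
  proof (rule bij_betw_byWitness[where f' = ?del])
    show "\<forall>p\<in>(SIGMA ys:?G A. ?I ys). ?del (?ins p) = p"
    proof
      fix p assume "p \<in> (SIGMA ys:?G A. ?I ys)"
      then obtain ys i where p: "p = (ys, i)"
        and ys: "ys \<in> permutations_of_set A" "i \<le> length ys"
        by blast
      have nin: "x \<notin> set (take i ys)"
        using nx ys(1) set_take_subset[of i ys] by (auto dest: permutations_of_setD)
      then have "takeWhile (\<lambda>y. y \<noteq> x) (take i ys @ x # drop i ys) = take i ys"
        by (subst takeWhile_append2) auto
      then show "?del (?ins p) = p"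
        unfolding p using nin ys(2) by (simp add: remove1_append)
    qed
    show "\<forall>xs\<in>?G (insert x A). ?ins (?del xs) = xs"
    proof
      fix xs assume "xs \<in> ?G (insert x A)"
      then have "x \<in> set xs"
        by (auto dest: permutations_of_setD)
      then obtain us vs where xs: "xs = us @ x # vs" "x \<notin> set us"
        by (meson split_list_first)
      have "takeWhile (\<lambda>y. y \<noteq> x) xs = us"
        unfolding xs(1) using xs(2) by (subst takeWhile_append2) auto
      then show "?ins (?del xs) = xs"
        using xs by (simp add: remove1_append)
    qed
    show "?ins ` (SIGMA ys:?G A. ?I ys) \<subseteq> ?G (insert x A)"
    proof
      fix xs assume "xs \<in> ?ins ` (SIGMA ys:?G A. ?I ys)"
      then obtain ys i where xs: "xs = ?ins (ys, i)"
        and ys: "ys \<in> permutations_of_set A" "tops ys \<subseteq> S"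
        and i: "i \<le> length ys" "i = 0 \<or> ys ! (i - 1) \<in> S"
        by blast
      have A: "set ys = A" "distinct ys"
        using ys(1) by (auto dest: permutations_of_setD)
      have "set (take i ys) \<union> set (drop i ys) = A"
        using A(1) by (metis append_take_drop_id set_append)
      then have "take i ys @ x # drop i ys \<in> permutations_of_set (insert x A)"
        using A nx set_take_disj_set_drop_if_distinct[OF A(2), of i i]
        by (intro permutations_of_setI) (auto dest: in_set_takeD in_set_dropD)
      then show "xs \<in> ?G (insert x A)"
        unfolding xs using good[OF A(1) i(1)] ys(2) i by simp
    qed
    show "?del ` ?G (insert x A) \<subseteq> (SIGMA ys:?G A. ?I ys)"
    proof
      fix p assume "p \<in> ?del ` ?G (insert x A)"
      then obtain xs where p: "p = ?del xs" and "xs \<in> ?G (insert x A)"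
        by blast
      then have set_xs: "set xs = insert x A" and dist: "distinct xs" and good_xs: "tops xs \<subseteq> S"
        by (auto dest: permutations_of_setD)
      then obtain us vs where xs: "xs = us @ x # vs" "x \<notin> set us"
        by (metis insertI1 split_list_first)
      have "takeWhile (\<lambda>y. y \<noteq> x) xs = us"
        unfolding xs(1) using xs(2) by (subst takeWhile_append2) auto
      then have p': "p = (us @ vs, length us)"
        using p xs by (simp add: remove1_append)
      have A: "set (us @ vs) = A" "distinct (us @ vs)"
        using set_xs dist nx unfolding xs(1) by auto
      have "tops (us @ vs) \<subseteq> S \<and> length us \<in> ?I (us @ vs)"
        using good[OF A(1), of "length us"] good_xs xs(1) by simp
      then show "p \<in> (SIGMA ys:?G A. ?I ys)"
        unfolding p' using A by (auto intro: permutations_of_setI)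
    qed
  qed
  then have "card (?G (insert x A)) = card (SIGMA ys:?G A. ?I ys)"
    by (simp add: bij_betw_same_card)
  also have "\<dots> = (\<Sum>ys\<in>?G A. card (?I ys))"
    by (rule card_SigmaI) (auto simp: fin)
  also have "\<dots> = (\<Sum>ys\<in>?G A. 1 + card (A \<inter> S))"
  proof (rule sum.cong[OF refl])
    fix ys assume "ys \<in> ?G A"
    then have "set ys = A" "distinct ys"
      by (auto dest: permutations_of_setD)
    then show "card (?I ys) = 1 + card (A \<inter> S)"
      using card_insert_positions by blast
  qed
  finally show ?thesis
    by simp
qed

lemma card_tops_subset:
  assumes "finite A"
  shows "card {xs \<in> permutations_of_set A. tops xs \<subseteq> S} = (\<Prod>x\<in>A. 1 + card {s \<in> A \<inter> S. x < s})"
  using assms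
proof (induction A rule: finite_linorder_min_induct)
  case empty
  have "{xs. xs = [] \<and> tops xs \<subseteq> S} = {[]}"
    by auto
  then show ?case
    by simp
next
  case (insert b A)
  have nb: "b \<notin> A"
    using insert.hyps by auto
  have "{s \<in> insert b A \<inter> S. b < s} = A \<inter> S"
    using insert.hyps by auto
  moreover have "(\<Prod>x\<in>A. 1 + card {s \<in> insert b A \<inter> S. x < s}) = (\<Prod>x\<in>A. 1 + card {s \<in> A \<inter> S. x < s})"
    by (intro prod.cong arg_cong[where f = "\<lambda>B. 1 + card B"])
      (use insert.hyps in \<open>auto dest: less_trans\<close>)
  ultimately show ?case
    using insert.hyps nb by (simp add: card_tops_subset_insert_min insert.IH)
qed

section \<open>Hat factorials as products over the ground set\<close>

text \<open>
  The hat factorial groups equal factors: if \<open>k\<close> is the size of \<open>X\<close>, all ground elements from the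
  \<open>j\<close>-th element of \<open>X\<close> up to, but excluding, the next one have \<open>k - j\<close> elements of \<open>X\<close> above them,
  and there are as many of them as the corresponding entry of \<open>alpha X\<close> says.
\<close>
lemma hat_fact_alpha:
  assumes "X \<subseteq> {1..M}"
  shows "hat_fact (alpha X) = (\<Prod>x\<in>{1..M}. 1 + card {s \<in> X. x < s})"
proof -
  have fin: "finite X"
    using assms finite_subset by blast
  define xs where "xs = sorted_list_of_set X"
  define k where "k = length xs"
  \<comment> \<open>Breakpoints: \<open>p j\<close> is the \<open>j\<close>-th element of \<open>X\<close> counted from one, and \<open>p 0 = 1\<close> is the start
    of the ground set, so that \<open>p (Suc i) - p i\<close> is \<open>alpha X ! i\<close>.\<close>
  define p where "p j = (if j = 0 then 1 else xs ! (j - 1))" for j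
  have set_xs: "set xs = X" and sorted: "sorted_wrt (<) xs"
    using fin by (auto simp: xs_def)
  have nth_in: "xs ! i \<in> {1..M}" if "i < k" for i
    using that assms set_xs by (metis k_def nth_mem subsetD)
  have nth_mono: "xs ! i < xs ! j" if "i < j" "j < k" for i j
    using that sorted by (simp add: k_def sorted_wrt_nth_less)
  have p_mono: "p j \<le> p (Suc j)" if "j < k" for j
    using that nth_in[of j] nth_mono[of "j - 1" j] by (auto simp: p_def)
  have p_ge: "1 \<le> p j" if "j \<le> k" for j
    using that nth_in[of "j - 1"] by (auto simp: p_def)
  have above: "card {s \<in> X. x < s} = k - j" if "j \<le> k" "p j \<le> x" "j < k \<Longrightarrow> x < p (Suc j)" for j x
  proof -
    have le_iff: "xs ! i \<le> x \<longleftrightarrow> i < j" if "i < k" for i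
    proof
      assume "i < j"
      then have "xs ! i \<le> xs ! (j - 1)"
        using nth_mono[of i "j - 1"] \<open>j \<le> k\<close> by (cases "i = j - 1") (auto intro: less_imp_le)
      then show "xs ! i \<le> x"
        using \<open>p j \<le> x\<close> \<open>i < j\<close> by (simp add: p_def)
    next
      assume le: "xs ! i \<le> x"
      show "i < j"
      proof (rule ccontr)
        assume "\<not> i < j"
        then have "xs ! j \<le> xs ! i"
          using nth_mono[of j i] that by (cases "i = j") auto
        then show False
          using le \<open>\<not> i < j\<close> \<open>i < k\<close> \<open>j < k \<Longrightarrow> x < p (Suc j)\<close> by (simp add: p_def)
      qed
    qed
    have "{s \<in> X. x < s} = (!) xs ` {j..<k}"
      using le_iff unfolding set_xs[symmetric] by (force simp: in_set_conv_nth k_def not_le[symmetric])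
    moreover have "inj_on ((!) xs) {j..<k}"
      by (intro inj_on_nth) (use sorted in \<open>auto simp: k_def strict_sorted_iff\<close>)
    ultimately show ?thesis
      by (simp add: card_image)
  qed
  have partial: "(\<Prod>i<j. (k + 1 - i) ^ (p (Suc i) - p i)) = (\<Prod>x\<in>{1..<p j}. 1 + card {s \<in> X. x < s})"
    if "j \<le> k" for j
    using that
  proof (induction j)
    case 0
    then show ?case
      by (simp add: p_def)
  next
    case (Suc j)
    have "(\<Prod>x\<in>{p j..<p (Suc j)}. 1 + card {s \<in> X. x < s}) = (\<Prod>x\<in>{p j..<p (Suc j)}. k + 1 - j)"
      using above[of j] Suc.prems by (intro prod.cong) auto
    then have "(\<Prod>i<Suc j. (k + 1 - i) ^ (p (Suc i) - p i))
        = (\<Prod>x\<in>{1..<p j}. 1 + card {s \<in> X. x < s}) * (\<Prod>x\<in>{p j..<p (Suc j)}. 1 + card {s \<in> X. x < s})"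
      using Suc by simp
    also have "\<dots> = (\<Prod>x\<in>{1..<p (Suc j)}. 1 + card {s \<in> X. x < s})"
      using p_ge[of j] p_mono[of j] Suc.prems by (intro prod.atLeastLessThan_concat) auto
    finally show ?case .
  qed
  have len: "length (alpha X) = k"
    by (simp add: alpha_def Let_def k_def xs_def)
  have nth: "alpha X ! i = p (Suc i) - p i" if "i < k" for i
    using that by (simp add: alpha_def Let_def k_def xs_def p_def)
  have "hat_fact (alpha X) = (\<Prod>i<k. (k + 1 - i) ^ (p (Suc i) - p i))"
    unfolding hat_fact_def len by (intro prod.cong) (auto simp: nth)
  also have "\<dots> = (\<Prod>x\<in>{1..<p k}. 1 + card {s \<in> X. x < s})"
    by (rule partial) simp
  also have "\<dots> = (\<Prod>x\<in>{1..M}. 1 + card {s \<in> X. x < s})"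
  proof (rule prod.mono_neutral_left)
    show "{1..<p k} \<subseteq> {1..M}"
      using nth_in[of "k - 1"] by (auto simp: p_def split: if_splits)
    \<comment> \<open>No element of \<open>X\<close> exceeds \<open>p k\<close>, so the ground elements from \<open>p k\<close> on contribute \<open>1\<close>.\<close>
    show "\<forall>x\<in>{1..M} - {1..<p k}. 1 + card {s \<in> X. x < s} = 1"
      using above[of k] by auto
  qed simp
  finally show ?thesis .
qed

text \<open>
  Shifting \<open>X\<close> by one shifts all factors and creates one more, for the new ground element \<open>1\<close>. All
  of \<open>Suc ` X\<close> lies above it.
\<close>
lemma hat_fact_alpha_Suc:
  assumes "X \<subseteq> {1..M}"
  shows "hat_fact (alpha (Suc ` X)) = (card X + 1) * hat_fact (alpha X)"
proof -
  have above: "card {s \<in> Suc ` X. Suc x < s} = card {s \<in> X. x < s}" for x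
  proof -
    have "{s \<in> Suc ` X. Suc x < s} = Suc ` {s \<in> X. x < s}"
      by auto
    then show ?thesis
      by (simp add: card_image)
  qed
  have "Suc ` X \<subseteq> {1..Suc M}"
    using assms by auto
  then have "hat_fact (alpha (Suc ` X)) = (\<Prod>x\<in>{1..Suc M}. 1 + card {s \<in> Suc ` X. x < s})"
    by (rule hat_fact_alpha)
  also have "\<dots> = (\<Prod>x\<in>{0..M}. 1 + card {s \<in> Suc ` X. Suc x < s})"
    using prod.shift_bounds_cl_Suc_ivl[of "\<lambda>x. 1 + card {s \<in> Suc ` X. x < s}" 0 M] by simp
  also have "\<dots> = (\<Prod>x\<in>{0..M}. 1 + card {s \<in> X. x < s})"
    unfolding above ..
  also have "\<dots> = (1 + card {s \<in> X. 0 < s}) * (\<Prod>x\<in>{1..M}. 1 + card {s \<in> X. x < s})"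
    by (simp add: prod.atLeast_Suc_atMost)
  also have "{s \<in> X. 0 < s} = X"
    using assms by auto
  finally show ?thesis
    using hat_fact_alpha[OF assms] by simp
qed

section \<open>Moebius inversion\<close>

lemma R_count_inclusion_exclusion:
  assumes "S \<subseteq> {1..M}" "0 < M"
  shows "int (R_count S) = (\<Sum>J\<in>Pow S. (- 1) ^ (card S - card J) * int (hat_fact (alpha J)))"
proof -
  let ?W = "permutations_of_set {1..M}"
  define f where "f S = int (card {xs \<in> ?W. tops xs = S})" for S
  define g where "g S = int (card {xs \<in> ?W. tops xs \<subseteq> S})" for S
  have fin: "finite S"
    using assms(1) finite_subset by blast
  have "g S = sum f (Pow S)" if "finite S" for S
  proof -
    have "{xs \<in> ?W. tops xs \<subseteq> S} = (\<Union>T\<in>Pow S. {xs \<in> ?W. tops xs = T})"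
      by auto
    moreover have "card (\<Union>T\<in>Pow S. {xs \<in> ?W. tops xs = T}) = (\<Sum>T\<in>Pow S. card {xs \<in> ?W. tops xs = T})"
      using that by (intro card_UN_disjoint) auto
    ultimately show ?thesis
      by (simp add: g_def f_def)
  qed
  then have "f S = (\<Sum>T\<in>Pow S. (- 1) ^ (card S - card T) * g T)"
    using fin by (rule inclusion_exclusion_mobius)
  also have "\<dots> = (\<Sum>J\<in>Pow S. (- 1) ^ (card S - card J) * int (hat_fact (alpha J)))"
  proof (rule sum.cong)
    fix J assume "J \<in> Pow S"
    then have J: "J \<subseteq> {1..M}"
      using assms(1) by auto
    then have "{1..M} \<inter> J = J"
      by auto
    then have "g J = int (hat_fact (alpha J))"
      unfolding g_def hat_fact_alpha[OF J] by (simp add: card_tops_subset)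
    then show "(- 1) ^ (card S - card J) * g J = (- 1) ^ (card S - card J) * int (hat_fact (alpha J))"
      by simp
  qed simp
  finally show ?thesis
    using R_count_eq_card_words[OF assms] by (simp add: f_def)
qed

section \<open>Complementing descent top sets\<close>

text \<open>
  Reversing the order exchanges descents and ascents, so it complements the descent top set, except
  at the last letter: having no successor, it is a descent top neither before nor after. A small
  letter \<open>z\<close> appended on one side only repairs this. It stands after the image here, and after the
  original word in the dual lemma that follows.
\<close>
lemma tops_map_antimono_snoc_min:
  assumes "distinct xs" "\<forall>a\<in>set xs. \<forall>b\<in>set xs. c b < c a \<longleftrightarrow> a < b" "\<forall>a\<in>set xs. z < c a"
  shows "tops (map c xs @ [z]) = c ` (set xs - tops xs)"
  using assms
proof (induction xs rule: tops.induct)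
  case (1 x y zs)
  have "x \<notin> tops (y # zs)"
    using 1(3) tops_subset_set[of "y # zs"] by auto
  then have "set (x # y # zs) - tops (x # y # zs)
      = (if y < x then {} else {x}) \<union> (set (y # zs) - tops (y # zs))"
    using 1(3) tops_subset_set[of "y # zs"] by auto
  moreover have "tops (map c (y # zs) @ [z]) = c ` (set (y # zs) - tops (y # zs))"
    by (cases "y < x") (rule 1; use 1(3-) in simp)+
  moreover have "c y < c x \<longleftrightarrow> x < y" "x \<noteq> y"
    using 1(3,4) by auto
  ultimately show ?case
    by auto
qed auto

lemma tops_map_antimono:
  assumes "distinct xs" "\<forall>a\<in>set xs. \<forall>b\<in>set xs. c b < c a \<longleftrightarrow> a < b" "\<forall>a\<in>set xs. z < a"
  shows "tops (map c xs) = c ` (set xs - tops (xs @ [z]))"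
  using assms
proof (induction xs rule: tops.induct)
  case (1 x y zs)
  have sub: "tops ((y # zs) @ [z]) \<subseteq> insert z (set (y # zs))"
    using tops_subset_set[of "(y # zs) @ [z]"] by auto
  then have "x \<notin> tops ((y # zs) @ [z])"
    using 1(3,5) by auto
  then have "set (x # y # zs) - tops ((x # y # zs) @ [z])
      = (if y < x then {} else {x}) \<union> (set (y # zs) - tops ((y # zs) @ [z]))"
    using 1(3) by auto
  moreover have "tops (map c (y # zs)) = c ` (set (y # zs) - tops ((y # zs) @ [z]))"
    by (cases "y < x") (rule 1; use 1(3-) in simp)+
  moreover have "c y < c x \<longleftrightarrow> x < y" "x \<noteq> y"
    using 1(3,4) by auto
  ultimately show ?case
    by auto
qed auto

text \<open>The map \<open>u 1 v \<mapsto> c(v) 1 c(u)\<close> on words, where \<open>1\<close> is the first letter of that value.\<close>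
definition swap_at_1 :: "(nat \<Rightarrow> nat) \<Rightarrow> nat list \<Rightarrow> nat list" where
  "swap_at_1 c xs =
    map c (tl (dropWhile (\<lambda>y. y \<noteq> 1) xs)) @ 1 # map c (takeWhile (\<lambda>y. y \<noteq> 1) xs)"

lemma swap_at_1_append: "1 \<notin> set us \<Longrightarrow> swap_at_1 c (us @ 1 # vs) = map c vs @ 1 # map c us"
  unfolding swap_at_1_def by (subst dropWhile_append2 takeWhile_append2; auto)+

text \<open>
  The involution \<open>swap_at_1 c\<close> exchanges the two sets. The swap of the two parts is needed because
  plain complementation would treat the last letter of the word wrongly: it is not a descent top,
  whatever it is mapped to. After the swap the letter \<open>1\<close> follows it, and the last letter of the
  other part, which did have \<open>1\<close> after it, takes its place.
\<close>
lemma card_tops_complement: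
  fixes M :: nat
  defines "c \<equiv> \<lambda>i. M + 2 - i"
  assumes M: "0 < M" and K: "K \<subseteq> {2..M}"
  shows "card {xs \<in> permutations_of_set {1..M}. tops xs = {2..M} - K}
    = card {xs \<in> permutations_of_set {1..M}. tops xs = c ` K}"
proof -
  let ?W = "permutations_of_set {1..M}"
  have c_c: "c (c i) = i" if "i \<in> {2..M}" for i
    using that by (auto simp: c_def)
  have c_in: "c i \<in> {2..M}" if "i \<in> {2..M}" for i
    using that by (auto simp: c_def)
  have c_less: "c j < c i \<longleftrightarrow> i < j" if "i \<in> {2..M}" "j \<in> {2..M}" for i j
    using that by (auto simp: c_def)
  have inj: "inj_on c {2..M}"
    by (metis c_c inj_onI)
  have image: "c ` {2..M} = {2..M}"
  proof
    show "{2..M} \<subseteq> c ` {2..M}"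
      by (metis c_c c_in image_eqI subsetI)
  qed (use c_in in auto)
  have swap: "swap_at_1 c xs \<in> ?W \<and> swap_at_1 c (swap_at_1 c xs) = xs
      \<and> tops (swap_at_1 c xs) = c ` ({2..M} - tops xs)" if "xs \<in> ?W" for xs
  proof -
    have set_xs: "set xs = {1..M}" and dist: "distinct xs"
      using that by (auto dest: permutations_of_setD)
    then have "1 \<in> set xs"
      using M by simp
    then obtain us vs where xs: "xs = us @ 1 # vs" and nus: "1 \<notin> set us"
      by (meson split_list_first)
    have nvs: "1 \<notin> set vs" and disj: "set us \<inter> set vs = {}"
      and du: "distinct us" and dv: "distinct vs"
      using dist unfolding xs by auto
    have "{2..M} = set xs - {1}"
      unfolding set_xs by auto
    then have un: "set us \<union> set vs = {2..M}"
      using nus nvs unfolding xs by auto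
    then have us: "set us \<subseteq> {2..M}" and vs: "set vs \<subseteq> {2..M}"
      by auto
    have eq: "swap_at_1 c xs = map c vs @ 1 # map c us"
      unfolding xs using nus by (rule swap_at_1_append)
    have ncvs: "1 \<notin> set (map c vs)" and ncus: "1 \<notin> set (map c us)"
      using us vs c_in by fastforce+
    have "swap_at_1 c (swap_at_1 c xs) = map c (map c us) @ 1 # map c (map c vs)"
      unfolding eq using ncvs by (rule swap_at_1_append)
    also have "\<dots> = xs"
      unfolding xs using us vs by (auto intro!: map_idI simp: c_c subset_iff)
    finally have invol: "swap_at_1 c (swap_at_1 c xs) = xs" .
    have "swap_at_1 c xs \<in> ?W"
    proof (rule permutations_of_setI)
      have "set (swap_at_1 c xs) = insert 1 (c ` (set us \<union> set vs))"
        unfolding eq by auto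
      also have "\<dots> = {1..M}"
        unfolding un image using M by auto
      finally show "set (swap_at_1 c xs) = {1..M}" .
      have "c ` set vs \<inter> c ` set us = {}"
        using inj_on_image_Int[OF inj vs us] disj by auto
      then show "distinct (swap_at_1 c xs)"
        unfolding eq using ncvs ncus du dv inj_on_subset[OF inj us] inj_on_subset[OF inj vs]
        by (simp add: distinct_map)
    qed
    moreover have "tops (swap_at_1 c xs) = c ` ({2..M} - tops xs)"
    proof -
      have "tops (swap_at_1 c xs) = tops (map c vs @ [1]) \<union> tops (map c us)"
      proof -
        have "\<forall>y\<in>set (map c us). 1 < y"
          using us c_in by fastforce
        then show ?thesis
          unfolding eq by (subst tops_append_Cons) (simp only: tops_Cons_min)
      qed
      also have "tops (map c vs @ [1]) = c ` (set vs - tops vs)"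
      proof (rule tops_map_antimono_snoc_min[OF dv])
        show "\<forall>a\<in>set vs. \<forall>b\<in>set vs. c b < c a \<longleftrightarrow> a < b"
          using vs c_less by blast
        show "\<forall>a\<in>set vs. 1 < c a"
          using vs c_in by fastforce
      qed
      also have "tops (map c us) = c ` (set us - tops (us @ [1]))"
      proof (rule tops_map_antimono[OF du])
        show "\<forall>a\<in>set us. \<forall>b\<in>set us. c b < c a \<longleftrightarrow> a < b"
          using us c_less by blast
        show "\<forall>a\<in>set us. 1 < a"
          using us by fastforce
      qed
      also have "c ` (set vs - tops vs) \<union> c ` (set us - tops (us @ [1])) = c ` ({2..M} - tops xs)"
      proof -
        have "tops xs = tops (us @ [1]) \<union> tops vs"
        proof -
          have "\<forall>y\<in>set vs. 1 < y"
            using vs by fastforce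
          then show ?thesis
            unfolding xs by (subst tops_append_Cons) (simp only: tops_Cons_min)
        qed
        moreover have "tops (us @ [1]) \<inter> set vs = {}" "tops vs \<inter> set us = {}"
          using tops_subset_set[of "us @ [1]"] tops_subset_set[of vs] disj nvs by auto
        ultimately have "{2..M} - tops xs = (set vs - tops vs) \<union> (set us - tops (us @ [1]))"
          unfolding un[symmetric] by auto
        then show ?thesis
          by (simp add: image_Un)
      qed
      finally show ?thesis .
    qed
    ultimately show ?thesis
      using invol by simp
  qed
  have "c ` c ` K = K"
    unfolding image_image using K by (auto simp: c_c subset_iff image_iff)
  have compl_compl: "c ` ({2..M} - c ` K) = {2..M} - K"
  proof -
    have "c ` K \<subseteq> {2..M}"
      using K image by blast
    then have "c ` ({2..M} - c ` K) = c ` {2..M} - c ` c ` K"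
      by (intro inj_on_image_set_diff[OF inj]) auto
    then show ?thesis
      unfolding image \<open>c ` c ` K = K\<close> .
  qed
  have "{2..M} - ({2..M} - K) = K"
    using K by auto
  then have "bij_betw (swap_at_1 c) {xs \<in> ?W. tops xs = {2..M} - K} {xs \<in> ?W. tops xs = c ` K}"
    using swap compl_compl by (intro bij_betw_byWitness[where f' = "swap_at_1 c"]) auto
  then show ?thesis
    by (rule bij_betw_same_card)
qed

section \<open>The alternating sum formulas\<close>

theorem corollary7p2:
  fixes n :: nat and K :: "nat set"
  assumes "K \<subseteq> {2..n + 1}"
  shows "R_count ({2..n + 2} - set_max n K) = R_count ({2..n + 1} - K)
    \<and> int (R_count ({2..n + 2} - K)) =
        (\<Sum>J\<in>Pow ({2..n + 1} - K). (- 1) ^ (n - card K - card J)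
           * (int (hat_fact (alpha (set_max n J))) - int (hat_fact (alpha J))))
    \<and> int (R_count ({2..n + 2} - K)) =
        (\<Sum>J\<in>Pow ({2..n + 1} - tau n ` K). (- 1) ^ (n - card K - card J)
           * (int (hat_fact (alpha (tau n ` set_min J))) - int (hat_fact (alpha (tau n ` J)))))
    \<and> int (R_count ({2..n + 2} - K)) =
        (\<Sum>J\<in>Pow K. (- 1) ^ (card K - card J) * int (hat_fact (alpha (tau (n + 1) ` J))))
    \<and> int (R_count ({2..n + 2} - K)) =
        (\<Sum>J\<in>Pow K. (- 1) ^ (card K - card J)
           * ((int (card J) + 1) * int (hat_fact (alpha (tau n ` J)))))
    \<and> R_count ({2..n + 2} - K) = R_count (tau (n + 1) ` K)"
proof -
  have finK: "finite K"
    using assms finite_subset by blast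
  define B where "B = {2..n + 1} - K"
  have finB: "finite B" and nB: "n + 2 \<notin> B"
    by (auto simp: B_def)
  have cardB: "card B = n - card K"
    using assms finK by (simp add: B_def card_Diff_subset)
  have S: "{2..n + 2} - K = insert (n + 2) B"
    using assms by (auto simp: B_def)
  have sub: "{2..n + 2} - K \<subseteq> {1..n + 2}"
    by auto

  have "{2..n + 2} - set_max n K = {2..n + 1} - K"
    by (auto simp: set_max_def)
  then have one: "R_count ({2..n + 2} - set_max n K) = R_count ({2..n + 1} - K)"
    by simp

  have two: "int (R_count ({2..n + 2} - K)) =
      (\<Sum>J\<in>Pow B. (- 1) ^ (n - card K - card J)
         * (int (hat_fact (alpha (set_max n J))) - int (hat_fact (alpha J))))"
  proof -
    let ?t = "\<lambda>J. (- 1) ^ (Suc (card B) - card J) * int (hat_fact (alpha J))"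
    have "int (R_count ({2..n + 2} - K)) = (\<Sum>J\<in>Pow (insert (n + 2) B). ?t J)"
      using R_count_inclusion_exclusion[OF sub] finB nB unfolding S by simp
    also have "\<dots> = (\<Sum>J\<in>Pow B. ?t J) + (\<Sum>J\<in>insert (n + 2) ` Pow B. ?t J)"
      unfolding Pow_insert using finB nB by (intro sum.union_disjoint) auto
    also have "(\<Sum>J\<in>insert (n + 2) ` Pow B. ?t J) = (\<Sum>J\<in>Pow B. ?t (insert (n + 2) J))"
    proof (rule sum.reindex_cong[OF _ refl refl])
      show "inj_on (insert (n + 2)) (Pow B)"
        using nB by (intro inj_onI) (metis Diff_insert_absorb PowD insert_absorb insert_ident subsetD)
    qed
    also have "(\<Sum>J\<in>Pow B. ?t J) + (\<Sum>J\<in>Pow B. ?t (insert (n + 2) J))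
        = (\<Sum>J\<in>Pow B. ?t J + ?t (insert (n + 2) J))"
      by (rule sum.distrib[symmetric])
    also have "\<dots> = (\<Sum>J\<in>Pow B. (- 1) ^ (n - card K - card J)
         * (int (hat_fact (alpha (set_max n J))) - int (hat_fact (alpha J))))"
    proof (rule sum.cong[OF refl])
      fix J assume "J \<in> Pow B"
      then have "finite J" "n + 2 \<notin> J" "card J \<le> card B"
        using finB nB by (auto intro: finite_subset card_mono)
      then show "?t J + ?t (insert (n + 2) J) = (- 1) ^ (n - card K - card J)
         * (int (hat_fact (alpha (set_max n J))) - int (hat_fact (alpha J)))"
        unfolding cardB[symmetric] by (simp add: set_max_def Suc_diff_le algebra_simps)
    qed
    finally show ?thesis .
  qed

  have tau_tau: "tau n (tau n i) = i" if "i \<in> {2..n + 1}" for i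
    using that by (auto simp: tau_def)
  have tau_in: "tau n i \<in> {2..n + 1}" if "i \<in> {2..n + 1}" for i
    using that by (auto simp: tau_def)
  have tau_tau_image: "tau n ` tau n ` J = J" if "J \<subseteq> {2..n + 1}" for J
    unfolding image_image using that tau_tau by (auto simp: subset_iff image_iff)
  have tau_inj: "inj_on (tau n) {2..n + 1}"
    by (metis tau_tau inj_onI)

  have three: "int (R_count ({2..n + 2} - K)) =
      (\<Sum>J\<in>Pow ({2..n + 1} - tau n ` K). (- 1) ^ (n - card K - card J)
         * (int (hat_fact (alpha (tau n ` set_min J))) - int (hat_fact (alpha (tau n ` J)))))"
    unfolding two
  proof (rule sum.reindex_bij_witness[where i = "image (tau n)" and j = "image (tau n)"])
    fix J assume "J \<in> Pow B"
    then have J: "J \<subseteq> {2..n + 1}" "J \<inter> K = {}"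
      by (auto simp: B_def)
    show JJ: "tau n ` tau n ` J = J"
      using J(1) by (rule tau_tau_image)
    have "tau n ` J \<inter> tau n ` K = {}"
      using inj_on_image_Int[OF tau_inj J(1) assms] J(2) by simp
    then show "tau n ` J \<in> Pow ({2..n + 1} - tau n ` K)"
      using J(1) tau_in by blast
    have "card (tau n ` J) = card J"
      using inj_on_subset[OF tau_inj J(1)] by (rule card_image)
    \<comment> \<open>Outside \<open>[2,n+1]\<close>, the map \<open>\<tau>\<^sub>n\<close> sends \<open>1\<close> to \<open>n+2\<close>.\<close>
    moreover have "tau n ` set_min (tau n ` J) = set_max n J"
      using JJ by (simp add: set_min_def set_max_def tau_def[of n "Suc 0"])
    ultimately show "(- 1) ^ (n - card K - card (tau n ` J))
         * (int (hat_fact (alpha (tau n ` set_min (tau n ` J)))) - int (hat_fact (alpha (tau n ` tau n ` J))))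
      = (- 1) ^ (n - card K - card J) * (int (hat_fact (alpha (set_max n J))) - int (hat_fact (alpha J)))"
      using JJ by simp
  next
    fix J assume "J \<in> Pow ({2..n + 1} - tau n ` K)"
    then have J: "J \<subseteq> {2..n + 1}" "J \<inter> tau n ` K = {}"
      by auto
    show JJ: "tau n ` tau n ` J = J"
      using J(1) by (rule tau_tau_image)
    have "tau n ` J \<inter> K = {}"
      using J JJ by blast
    then show "tau n ` J \<in> Pow B"
      using J(1) tau_in unfolding B_def by blast
  qed

  have tau_fun: "tau (n + 1) = (\<lambda>i. n + 2 + 2 - i)"
    by (auto simp: tau_def fun_eq_iff)
  have subK: "tau (n + 1) ` K \<subseteq> {1..n + 2}"
    using assms by (auto simp: tau_def dest!: subsetD)
  have injK: "inj_on (tau (n + 1)) K"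
    using assms by (intro inj_onI) (auto simp: tau_def subset_iff)
  have six: "R_count ({2..n + 2} - K) = R_count (tau (n + 1) ` K)"
  proof -
    have "K \<subseteq> {2..n + 2}"
      using assms by auto
    then show ?thesis
      using card_tops_complement[of "n + 2" K] R_count_eq_card_words[OF sub]
        R_count_eq_card_words[OF subK] unfolding tau_fun by simp
  qed

  have four: "int (R_count ({2..n + 2} - K)) =
      (\<Sum>J\<in>Pow K. (- 1) ^ (card K - card J) * int (hat_fact (alpha (tau (n + 1) ` J))))"
  proof -
    have "int (R_count ({2..n + 2} - K)) = (\<Sum>J\<in>Pow (tau (n + 1) ` K).
        (- 1) ^ (card K - card J) * int (hat_fact (alpha J)))"
      unfolding six card_image[OF injK, symmetric] using subK by (rule R_count_inclusion_exclusion) simp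
    also have "\<dots> = (\<Sum>J\<in>Pow K. (- 1) ^ (card K - card J) * int (hat_fact (alpha (tau (n + 1) ` J))))"
    proof (rule sum.reindex_cong[where l = "image (tau (n + 1))"])
      show "inj_on (image (tau (n + 1))) (Pow K)"
        using injK by (rule inj_on_image_Pow)
      show "Pow (tau (n + 1) ` K) = image (tau (n + 1)) ` Pow K"
        by (simp add: image_Pow_surj)
      fix J assume "J \<in> Pow K"
      then have "card (tau (n + 1) ` J) = card J"
        using inj_on_subset[OF injK] by (intro card_image) auto
      then show "(- 1) ^ (card K - card (tau (n + 1) ` J)) * int (hat_fact (alpha (tau (n + 1) ` J)))
          = (- 1) ^ (card K - card J) * int (hat_fact (alpha (tau (n + 1) ` J)))"
        by simp
    qed
    finally show ?thesis .
  qed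

  have five: "int (R_count ({2..n + 2} - K)) =
      (\<Sum>J\<in>Pow K. (- 1) ^ (card K - card J)
         * ((int (card J) + 1) * int (hat_fact (alpha (tau n ` J)))))"
    unfolding four
  proof (rule sum.cong[OF refl])
    fix J assume "J \<in> Pow K"
    then have J: "J \<subseteq> {2..n + 1}"
      using assms by auto
    have Suc_tau: "tau (n + 1) ` J = Suc ` tau n ` J"
      unfolding image_image using J by (intro image_cong) (auto simp: tau_def subset_iff)
    have "tau n ` J \<subseteq> {1..n + 2}"
      using J by (auto simp: tau_def dest!: subsetD)
    then have "hat_fact (alpha (tau (n + 1) ` J)) = (card (tau n ` J) + 1) * hat_fact (alpha (tau n ` J))"
      unfolding Suc_tau by (rule hat_fact_alpha_Suc)
    moreover have "card (tau n ` J) = card J"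
      using inj_on_subset[OF tau_inj J] by (rule card_image)
    ultimately show "(- 1) ^ (card K - card J) * int (hat_fact (alpha (tau (n + 1) ` J)))
        = (- 1) ^ (card K - card J) * ((int (card J) + 1) * int (hat_fact (alpha (tau n ` J))))"
      by (simp add: algebra_simps)
  qed

  show ?thesis
    using one two three four five six unfolding B_def by blast
qed

end
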